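(* Let $\hat{A}\in\mathbb{DC}^{n\times n}$, and let $A_e$ be its essential part. Then the following are equivalent, where each condition involving $A_e^{\#}$ is understood to include the requirement that the dual group generalized inverse $A_e^{\#}$ exists: (i) $\hat{A}$ is new dual EP; (ii) $\hat{A}\hat{A}^N\hat{A}^*=\hat{A}^*\hat{A}\hat{A}^N$; (iii) $\hat{A}^*\hat{A}^N\hat{A}=\hat{A}^N\hat{A}\hat{A}^*$; (iv) $\hat{A}^N\hat{A}^N=\hat{A}^NA_e^{\#}$; (v) $\hat{A}^N\hat{A}^N=A_e^{\#}\hat{A}^N$; (vi) $\hat{A}^N\hat{A}^N=A_e^{\#}A_e^{\#}$; (vii) $A_e^{\#}\hat{A}^N=A_e^{\#}A_e^{\#}$; (viii) $\hat{A}^NA_e^{\#}=A_e^{\#}A_e^{\#}$; (ix) $\hat{A}^NA_e^{\#}=A_e^{\#}\hat{A}^N$; (x) $\hat{A}^N\hat{A}^NA_e^{\#}=\hat{A}^NA_e^{\#}\hat{A}^N$; (xi) $\hat{A}^N\hat{A}^NA_e^{\#}=A_e^{\#}\hat{A}^N\hat{A}^N$; (xii) $\hat{A}^NA_e^{\#}\hat{A}^N=A_e^{\#}\hat{A}^N\hat{A}^N$; (xiii) $\hat{A}^NA_e^{\#}A_e^{\#}=A_e^{\#}\hat{A}^NA_e^{\#}$; (xiv) $\hat{A}^NA_e^{\#}A_e^{\#}=A_e^{\#}A_e^{\#}\hat{A}^N$; (xv) $A_e^{\#}A_e^{\#}\hat{A}^N=A_e^{\#}\hat{A}^NA_e^{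\#}$.
   Context: $\mathbb{D}$ is the ring of dual numbers $\hat a=a_s+a_d\epsilon$ with $a_s,a_d\in\mathbb{R}$ and $\epsilon^2=0$; $\mathbb{DC}$ is the ring of dual complex numbers, defined in the same way with $a_s,a_d\in\mathbb{C}$. A dual number is appreciable if $a_s\ne0$ and infinitesimal if $a_s=0$. $\mathbb{D}$ is totally ordered by: $\hat a<\hat b$ iff $a_s<b_s$, or $a_s=b_s$ and $a_d<b_d$. Every $\hat{A}\in\mathbb{DC}^{m\times n}$ is written $\hat{A}=A_s+A_d\epsilon$ with $A_s,A_d$ complex matrices, and $\hat{A}^*=A_s^*+A_d^*\epsilon$ (conjugate transpose). $\hat{U}$ is unitary if $\hat{U}^*\hat{U}=\hat{U}\hat{U}^*=I$. SVD (known theorem): every $\hat{A}\in\mathbb{DC}^{m\times n}$ can be written $\hat{A}=\hat{U}\begin{bmatrix}\hat{\Sigma}_1&O\\O&\hat{\Sigma}_2\end{bmatrix}\hat{V}^*$ with $\hat{U}\in\mathbb{DC}^{m\times m}$, $\hat{V}\in\mathbb{DC}^{n\times n}$ unitary, $\hat{\Sigma}_1=\mathrm{diag}(\hat{\mu}_1,\dots,\hat{\mu}_r)$ with $\hat{\mu}_1\ge\dots\ge\hat{\mu}_r$ positive appreciable dual numbers, and $\hat{\Sigma}_2=\mathrm{diag}(\hat{\mu}_{r+1},\dots,\hat{\mu}_t,0,\dots,0)$ of size $(m-r)\times(n-r)$ with $\hat{\mu}_{r+1}\ge\dots\ge\hat{\mu}_t$ positive infinitesimal dual numbers. The essential part of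 $\hat{A}$ is $A_e=\hat{U}\begin{bmatrix}\hat{\Sigma}_1&O\\O&O\end{bmatrix}\hat{V}^*$ (it does not depend on the chosen SVD). The NDMPI (new dual Moore-Penrose inverse) $\hat{A}^N$ of $\hat{A}$ is the unique $\hat{X}$ with $\hat{A}\hat{X}\hat{A}=A_e$, $\hat{X}\hat{A}\hat{X}=\hat{X}$, $(\hat{A}\hat{X})^*=\hat{A}\hat{X}$, $(\hat{X}\hat{A})^*=\hat{X}\hat{A}$; it always exists. The dual group generalized inverse (DGGI) $\hat{B}^{\#}$ of a square $\hat{B}$ is, when it exists, the unique $\hat{X}$ with $\hat{B}\hat{X}\hat{B}=\hat{B}$, $\hat{X}\hat{B}\hat{X}=\hat{X}$, $\hat{B}\hat{X}=\hat{X}\hat{B}$. $\hat{A}\in\mathbb{DC}^{n\times n}$ is new dual EP if $\hat{A}\hat{A}^N=\hat{A}^N\hat{A}$. *)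

theory Defs
  imports "Jordan_Normal_Form.Matrix"
begin

section \<open>Dual numbers over a commutative ring\<close>

text \<open>\<open>Dual a b\<close> stands for \<open>a + b \<epsilon>\<close> with \<open>\<epsilon>\<^sup>2 = 0\<close>. The type \<open>real dual\<close> is the ring of dual
  numbers and \<open>complex dual\<close> the ring of dual complex numbers.\<close>

datatype 'a dual = Dual (st_part: 'a) (inf_part: 'a)

instantiation dual :: (comm_ring_1) comm_ring_1
begin

definition "0 = Dual 0 0"
definition "1 = Dual 1 0"
definition "a + b = Dual (st_part a + st_part b) (inf_part a + inf_part b)"
definition "a - b = Dual (st_part a - st_part b) (inf_part a - inf_part b)"
definition "- a = Dual (- st_part a) (- inf_part a)"
definition "a * b = Dual (st_part a * st_part b) (st_part a * inf_part b + inf_part a * st_part b)"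

instance
  by intro_classes
    (auto simp: zero_dual_def one_dual_def plus_dual_def minus_dual_def uminus_dual_def
      times_dual_def algebra_simps)

end

text \<open>The lexicographic total order.\<close>

instantiation dual :: (linorder) linorder
begin

definition "a < b \<longleftrightarrow> st_part a < st_part b \<or> (st_part a = st_part b \<and> inf_part a < inf_part b)"
definition "a \<le> (b :: 'a dual) \<longleftrightarrow> a < b \<or> a = b"

instance
  by intro_classes (auto simp: less_dual_def less_eq_dual_def intro: dual.expand)

end

instantiation dual :: ("{comm_ring_1, conjugatable_ring}") conjugatable_ring
begin

definition "conjugate a = Dual (conjugate (st_part a)) (conjugate (inf_part a))"

instance
  by intro_classes
    (auto simp: conjugate_dual_def zero_dual_def plus_dual_def uminus_dual_def times_dual_def
      conjugate_dist_mul conjugate_dist_add conjugate_neg intro: dual.expand)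

end

definition appreciable :: "'a::zero dual \<Rightarrow> bool" where
  "appreciable a \<longleftrightarrow> st_part a \<noteq> 0"

definition infinitesimal :: "'a::zero dual \<Rightarrow> bool" where
  "infinitesimal a \<longleftrightarrow> st_part a = 0"

definition complex_of_dual :: "real dual \<Rightarrow> complex dual" where
  "complex_of_dual = map_dual complex_of_real"

section \<open>Matrices of dual complex numbers\<close>

text \<open>A matrix \<open>A\<^sub>s + A\<^sub>d \<epsilon>\<close> is represented by the matrix of its entries, which lie in
  \<open>complex dual\<close>; entrywise conjugation acts on both parts, so \<open>conj_transpose\<close> is
  \<open>A\<^sub>s\<^sup>* + A\<^sub>d\<^sup>* \<epsilon>\<close>.\<close>

definition conj_transpose :: "complex dual mat \<Rightarrow> complex dual mat" where
  "conj_transpose A = transpose_mat (map_mat conjugate A)"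

definition is_unitary :: "nat \<Rightarrow> complex dual mat \<Rightarrow> bool" where
  "is_unitary k U \<longleftrightarrow> U \<in> carrier_mat k k \<and> conj_transpose U * U = 1\<^sub>m k \<and> U * conj_transpose U = 1\<^sub>m k"

text \<open>The \<open>m \<times> n\<close> matrix \<open>diag(x\<^sub>1, \<dots>, x\<^sub>k, 0, \<dots>, 0)\<close>, where \<open>xs = [x\<^sub>1, \<dots>, x\<^sub>k]\<close>.
  It is only used for \<open>k \<le> min m n\<close>.\<close>

definition rect_diag :: "nat \<Rightarrow> nat \<Rightarrow> real dual list \<Rightarrow> complex dual mat" where
  "rect_diag m n xs =
     mat m n (\<lambda>(i, j). if i = j \<and> i < length xs then complex_of_dual (xs ! i) else 0)"

text \<open>\<open>mus\<close> lists the appreciable singular values \<open>\<mu>\<^sub>1 \<ge> \<dots> \<ge> \<mu>\<^sub>r\<close> and \<open>nus\<close> the infinitesimal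
  ones \<open>\<mu>\<^bsub>r+1\<^esub> \<ge> \<dots> \<ge> \<mu>\<^sub>t\<close>.\<close>

definition is_dual_svd ::
  "complex dual mat \<Rightarrow> complex dual mat \<Rightarrow> real dual list \<Rightarrow> real dual list \<Rightarrow>
   complex dual mat \<Rightarrow> bool" where
  "is_dual_svd A U mus nus V \<longleftrightarrow>
     (let m = dim_row A; n = dim_col A; r = length mus in
        is_unitary m U \<and> is_unitary n V \<and>
        r + length nus \<le> min m n \<and>
        sorted_wrt (\<ge>) mus \<and> (\<forall>x \<in> set mus. appreciable x \<and> x > Dual 0 0) \<and>
        sorted_wrt (\<ge>) nus \<and> (\<forall>x \<in> set nus. infinitesimal x \<and> x > Dual 0 0) \<and>
        A = U * four_block_mat (rect_diag r r mus) (0\<^sub>m r (n - r))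
                  (0\<^sub>m (m - r) r) (rect_diag (m - r) (n - r) nus) * conj_transpose V)"

definition is_essential_part :: "complex dual mat \<Rightarrow> complex dual mat \<Rightarrow> bool" where
  "is_essential_part A E \<longleftrightarrow>
     (\<exists>U mus nus V. is_dual_svd A U mus nus V \<and>
        (let m = dim_row A; n = dim_col A; r = length mus in
           E = U * four_block_mat (rect_diag r r mus) (0\<^sub>m r (n - r))
                     (0\<^sub>m (m - r) r) (0\<^sub>m (m - r) (n - r)) * conj_transpose V))"

section \<open>Generalized inverses\<close>

text \<open>Both inverses are unique when they exist, and are given as relations: the matrix is determined
  by its defining equations, and no value is chosen when there is none.\<close>

text \<open>\<open>is_ndmpi A X\<close>: \<open>X\<close> is the new dual Moore-Penrose inverse of \<open>A\<close>.\<close>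

definition is_ndmpi :: "complex dual mat \<Rightarrow> complex dual mat \<Rightarrow> bool" where
  "is_ndmpi A X \<longleftrightarrow>
     X \<in> carrier_mat (dim_col A) (dim_row A) \<and>
     is_essential_part A (A * X * A) \<and>
     X * A * X = X \<and>
     conj_transpose (A * X) = A * X \<and>
     conj_transpose (X * A) = X * A"

text \<open>\<open>is_dggi B X\<close>: \<open>X\<close> is the dual group generalized inverse of the square matrix \<open>B\<close>.\<close>

definition is_dggi :: "complex dual mat \<Rightarrow> complex dual mat \<Rightarrow> bool" where
  "is_dggi B X \<longleftrightarrow>
     X \<in> carrier_mat (dim_row B) (dim_row B) \<and>
     B * X * B = B \<and> X * B * X = X \<and> B * X = X * B"

definition new_dual_EP :: "complex dual mat \<Rightarrow> bool" where
  "new_dual_EP A \<longleftrightarrow> (\<exists>X. is_ndmpi A X \<and> A * X = X * A)"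

end

theory Submission
  imports Defs
begin

text \<open>Once the essential part \<open>E\<close> is known to be unique, \<open>A * N = E * N\<close> and \<open>N * A = N * E\<close>, so \<open>N\<close> is
  an ordinary Moore-Penrose inverse of \<open>E\<close> and new dual EP means that the Hermitian projectors
  \<open>P = E * N\<close> and \<open>Q = N * E\<close> coincide. Each condition forces one of them to absorb the other; as they
  have the same trace, and a Hermitian idempotent of trace zero vanishes even over the dual numbers
  (its standard part vanishes, so it is its own square with infinitesimal entries), they are then
  equal. If \<open>E\<close> has a group inverse \<open>G\<close>, then \<open>T = E * G\<close> is a third projector, with the range of
  \<open>P\<close> and the kernel of \<open>Q\<close>, and the conditions are compared through \<open>T\<close>.\<close>

section \<open>Conjugate transposes\<close>

lemma conj_transpose_carrier [simp]:
  "A \<in> carrier_mat m n \<Longrightarrow> conj_transpose A \<in> carrier_mat n m"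
  by (auto simp: conj_transpose_def)

lemma conj_transpose_conj_transpose [simp]: "conj_transpose (conj_transpose A) = A"
  by (auto simp: conj_transpose_def)

lemma conj_transpose_mult:
  assumes "A \<in> carrier_mat m n" "B \<in> carrier_mat n k"
  shows "conj_transpose (A * B) = conj_transpose B * conj_transpose A"
  using assms
  by (intro eq_matI)
    (auto simp: conj_transpose_def scalar_prod_def sum_conjugate conjugate_dist_mul mult.commute
      intro!: sum.cong)

lemma conj_transpose_minus:
  assumes "A \<in> carrier_mat m n" "B \<in> carrier_mat m n"
  shows "conj_transpose (A - B) = conj_transpose A - conj_transpose B"
proof -
  have "conjugate (x - y) = conjugate x - conjugate y" for x y :: "complex dual"
    by (metis conjugate_dist_add conjugate_neg diff_conv_add_uminus)
  then show ?thesis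
    using assms by (intro eq_matI) (auto simp: conj_transpose_def)
qed

section \<open>Hermitian idempotents and the trace\<close>

definition mtrace :: "'a::comm_monoid_add mat \<Rightarrow> 'a" where
  "mtrace A = (\<Sum>i<dim_row A. A $$ (i, i))"

lemma mtrace_mult_commute:
  fixes A B :: "'a::comm_semiring_0 mat"
  assumes "A \<in> carrier_mat m n" "B \<in> carrier_mat n m"
  shows "mtrace (A * B) = mtrace (B * A)"
proof -
  have "mtrace (A * B) = (\<Sum>i<m. \<Sum>j<n. A $$ (i, j) * B $$ (j, i))"
    using assms by (auto simp: mtrace_def scalar_prod_def atLeast0LessThan)
  also have "\<dots> = (\<Sum>j<n. \<Sum>i<m. B $$ (j, i) * A $$ (i, j))"
    by (subst sum.swap) (simp add: mult.commute)
  also have "\<dots> = mtrace (B * A)"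
    using assms by (auto simp: mtrace_def scalar_prod_def atLeast0LessThan)
  finally show ?thesis .
qed

lemma mtrace_minus:
  fixes A B :: "'a::ab_group_add mat"
  assumes "A \<in> carrier_mat n n" "B \<in> carrier_mat n n"
  shows "mtrace (A - B) = mtrace A - mtrace B"
  using assms by (auto simp: mtrace_def sum_subtractf)

lemma st_part_sum: "st_part (\<Sum>x\<in>S. f x) = (\<Sum>x\<in>S. st_part (f x))"
  by (induction S rule: infinite_finite_induct) (auto simp: zero_dual_def plus_dual_def)

lemma mult_infinitesimal: "st_part a = 0 \<Longrightarrow> st_part b = 0 \<Longrightarrow> a * b = 0"
  by (simp add: times_dual_def zero_dual_def)

text \<open>As \<open>R\<close> is Hermitian, the standard part of the trace of
  \<open>R * R = R\<close> is the sum of the squared moduli of the standard parts of all entries.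
  Trace zero thus leaves only infinitesimal entries, whose products vanish.\<close>

lemma hermitian_idempotent_trace_0:
  assumes R: "R \<in> carrier_mat n n" and idem: "R * R = R"
    and herm: "conj_transpose R = R" and tr: "mtrace R = 0"
  shows "R = 0\<^sub>m n n"
proof -
  have entry: "R $$ (i, j) = (\<Sum>k<n. R $$ (i, k) * R $$ (k, j))" if "i < n" "j < n" for i j
    using R that by (subst idem [symmetric]) (simp add: scalar_prod_def atLeast0LessThan)
  have conj: "R $$ (k, i) = conjugate (R $$ (i, k))" if "i < n" "k < n" for i k
    using R that by (subst herm [symmetric]) (simp add: conj_transpose_def)
  have modulus: "st_part (R $$ (i, k) * R $$ (k, i)) =
      complex_of_real ((cmod (st_part (R $$ (i, k))))\<^sup>2)" if "i < n" "k < n" for i k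
    unfolding conj [OF that] complex_norm_square by (simp add: times_dual_def conjugate_dual_def)
  have "0 = st_part (mtrace R)"
    by (simp add: tr zero_dual_def)
  also have "mtrace R = (\<Sum>i<n. \<Sum>k<n. R $$ (i, k) * R $$ (k, i))"
    unfolding mtrace_def carrier_matD(1) [OF R] by (intro sum.cong refl entry) auto
  also have "st_part \<dots> = (\<Sum>i<n. \<Sum>k<n. complex_of_real ((cmod (st_part (R $$ (i, k))))\<^sup>2))"
    unfolding st_part_sum by (intro sum.cong refl modulus) auto
  also have "\<dots> = complex_of_real (\<Sum>i<n. \<Sum>k<n. (cmod (st_part (R $$ (i, k))))\<^sup>2)"
    by simp
  finally have "complex_of_real (\<Sum>i<n. \<Sum>k<n. (cmod (st_part (R $$ (i, k))))\<^sup>2) = 0"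
    by (rule sym)
  then have "(\<Sum>i<n. \<Sum>k<n. (cmod (st_part (R $$ (i, k))))\<^sup>2) = 0"
    by (simp only: of_real_eq_0_iff)
  then have "st_part (R $$ (i, k)) = 0" if "i < n" "k < n" for i k
    using that by (simp add: sum_nonneg_eq_0_iff sum_nonneg)
  then have "R $$ (i, j) = 0" if "i < n" "j < n" for i j
    unfolding entry [OF that] using that by (intro sum.neutral ballI mult_infinitesimal) auto
  then show ?thesis
    using R by (intro eq_matI) auto
qed

text \<open>The adjoint of \<open>P * Q = Q\<close> is \<open>Q * P = Q\<close>, so
  \<open>P - Q\<close> is again a Hermitian idempotent, now of trace zero.\<close>

lemma nested_projectors_eq:
  assumes P: "P \<in> carrier_mat n n" and Q: "Q \<in> carrier_mat n n"
    and herm: "conj_transpose P = P" "conj_transpose Q = Q"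
    and idem: "P * P = P" "Q * Q = Q"
    and nest: "P * Q = Q" and tr: "mtrace P = mtrace Q"
  shows "P = Q"
proof -
  have nest': "Q * P = Q"
    using conj_transpose_mult [OF P Q] herm nest by simp
  have "(P - Q) * (P - Q) = P * P - P * Q - (Q * P - Q * Q)"
    by (simp only: minus_mult_distrib_mat [OF P Q minus_carrier_mat [OF Q]]
        mult_minus_distrib_mat [OF P P Q] mult_minus_distrib_mat [OF Q P Q])
  also have "\<dots> = P - Q"
    unfolding idem nest nest' using P Q by (intro eq_matI) auto
  finally have "P - Q = 0\<^sub>m n n"
    using P Q herm tr
    by (intro hermitian_idempotent_trace_0) (auto simp: conj_transpose_minus mtrace_minus)
  then have "P $$ (i, j) - Q $$ (i, j) = 0" if "i < n" "j < n" for i j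
    using P Q that by (metis carrier_matD index_minus_mat(1) index_zero_mat(1))
  then show ?thesis
    using P Q by (intro eq_matI) auto
qed

section \<open>Uniqueness of the essential part\<close>

definition diagonal :: "nat \<Rightarrow> nat \<Rightarrow> (nat \<Rightarrow> 'a::zero) \<Rightarrow> 'a mat" where
  "diagonal m n d = mat m n (\<lambda>(i, j). if i = j then d i else 0)"

lemma diagonal_carrier [simp]: "diagonal m n d \<in> carrier_mat m n"
  by (simp add: diagonal_def)

lemma conj_transpose_diagonal:
  "conj_transpose (diagonal m n d) = diagonal n m (\<lambda>i. conjugate (d i))"
  by (intro eq_matI) (auto simp: conj_transpose_def diagonal_def)

text \<open>The inner dimension \<open>n\<close> may be smaller than \<open>m\<close> and
  \<open>k\<close>; diagonal entries of the product beyond it vanish, hence the guard.\<close>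

lemma diagonal_mult:
  fixes d e :: "nat \<Rightarrow> 'a::semiring_0"
  shows "diagonal m n d * diagonal n k e = diagonal m k (\<lambda>i. if i < n then d i * e i else 0)"
proof (rule eq_matI)
  fix i j assume "i < dim_row (diagonal m k (\<lambda>i. if i < n then d i * e i else 0))"
    "j < dim_col (diagonal m k (\<lambda>i. if i < n then d i * e i else 0))"
  then have ij: "i < m" "j < k"
    by (auto simp: diagonal_def)
  then have "(diagonal m n d * diagonal n k e) $$ (i, j) =
      (\<Sum>l\<in>{0..<n}. (if i = l then d i else 0) * (if l = j then e l else 0))"
    by (simp add: diagonal_def scalar_prod_def)
  also have "\<dots> = (\<Sum>l\<in>{0..<n}. if i = l then (if i = j then d i * e i else 0) else 0)"
    by (rule sum.cong) auto
  finally show "(diagonal m n d * diagonal n k e) $$ (i, j) =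
      diagonal m k (\<lambda>i. if i < n then d i * e i else 0) $$ (i, j)"
    using ij by (auto simp: diagonal_def)
qed (auto simp: diagonal_def)

lemma diagonal_cong: "(\<And>i. i < m \<Longrightarrow> i < n \<Longrightarrow> d i = e i) \<Longrightarrow> diagonal m n d = diagonal m n e"
  by (auto simp: diagonal_def)

lemma conjugate_complex_of_dual [simp]: "conjugate (complex_of_dual x) = complex_of_dual x"
  by (cases x) (simp add: conjugate_dual_def complex_of_dual_def)

lemma conjugate_one_dual [simp]: "conjugate (1 :: complex dual) = 1"
  by (simp add: one_dual_def conjugate_dual_def)

lemma appreciable_square_inverse:
  assumes "appreciable x"
  shows "\<exists>y. complex_of_dual x * complex_of_dual x * y = 1"
proof -
  obtain a b where x: "x = Dual a b"
    by (cases x)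
  \<comment> \<open>The witness is the expansion of the inverse square of a + b eps to first order
    in eps.\<close>
  then have "complex_of_dual x * complex_of_dual x *
      Dual (1 / of_real a ^ 2) (- 2 * of_real b / of_real a ^ 3) = 1"
    using assms
    by (simp add: appreciable_def complex_of_dual_def times_dual_def one_dual_def field_simps
        power2_eq_square power3_eq_cube)
  then show ?thesis by blast
qed

text \<open>The projector onto the left singular vectors of appreciable singular values. As infinitesimal
  singular values have square zero, it fixes \<open>A * conj_transpose A\<close> from the left and is a right
  multiple of it, which determines it without reference to the decomposition.\<close>

lemma essential_part_projector:
  assumes A: "A \<in> carrier_mat m n" and E: "is_essential_part A E"
  obtains P Z where "P \<in> carrier_mat m m" "Z \<in> carrier_mat m m" "conj_transpose P = P" "P * A = E"
    "P * (A * conj_transpose A) = A * conj_transpose A" "P = A * conj_transpose A * Z"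
proof -
  obtain U mus nus V where svd: "is_dual_svd A U mus nus V" and
    E: "E = U * four_block_mat (rect_diag (length mus) (length mus) mus) (0\<^sub>m (length mus) (n - length mus))
      (0\<^sub>m (m - length mus) (length mus)) (0\<^sub>m (m - length mus) (n - length mus)) * conj_transpose V"
    using A E by (auto simp: is_essential_part_def Let_def)
  define r where "r = length mus"
  define d where "d i = (if i < r then complex_of_dual (mus ! i)
    else if i < r + length nus then complex_of_dual (nus ! (i - r)) else 0)" for i
  define e where "e i = (if i < r then d i else 0)" for i
  define W where "W = conj_transpose V"
  have U: "is_unitary m U" and V: "is_unitary n V" and len: "r + length nus \<le> min m n"
    and mus: "\<forall>x\<in>set mus. appreciable x" and nus: "\<forall>x\<in>set nus. infinitesimal x"
    and A': "A = U * four_block_mat (rect_diag r r mus) (0\<^sub>m r (n - r))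
      (0\<^sub>m (m - r) r) (rect_diag (m - r) (n - r) nus) * W"
    using svd A by (auto simp: is_dual_svd_def Let_def r_def W_def)
  have "four_block_mat (rect_diag r r mus) (0\<^sub>m r (n - r))
      (0\<^sub>m (m - r) r) (rect_diag (m - r) (n - r) nus) = diagonal m n d"
    using len by (intro eq_matI)
      (auto simp: four_block_mat_def Let_def rect_diag_def diagonal_def d_def r_def)
  with A' have AD: "A = U * diagonal m n d * W" by simp
  have "four_block_mat (rect_diag r r mus) (0\<^sub>m r (n - r))
      (0\<^sub>m (m - r) r) (0\<^sub>m (m - r) (n - r)) = diagonal m n e"
    using len by (intro eq_matI)
      (auto simp: four_block_mat_def Let_def rect_diag_def diagonal_def d_def e_def r_def)
  with E have ED: "E = U * diagonal m n e * W" by (simp add: r_def W_def)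
  have Uc [simp]: "U \<in> carrier_mat m m" and UU: "conj_transpose U * U = 1\<^sub>m m"
    using U by (auto simp: is_unitary_def)
  have Wc [simp]: "W \<in> carrier_mat n n" and WW: "W * conj_transpose W = 1\<^sub>m n"
    using V by (auto simp: is_unitary_def W_def)
  note assoc = assoc_mult_mat [of _ m m _ m _ m] assoc_mult_mat [of _ m m _ n _ n]
    assoc_mult_mat [of _ m m _ m _ n] assoc_mult_mat [of _ m n _ n _ m]
    assoc_mult_mat [of _ m m _ n _ m] assoc_mult_mat [of _ m n _ m _ m]
    assoc_mult_mat [of _ n n _ n _ m] assoc_mult_mat [of _ n n _ m _ m]
    assoc_mult_mat [of _ m n _ n _ n]
  note [simp] = mult_carrier_mat [of _ m m _ m] mult_carrier_mat [of _ m m _ n]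
    mult_carrier_mat [of _ m n _ n] mult_carrier_mat [of _ m n _ m]
    mult_carrier_mat [of _ n n _ n] mult_carrier_mat [of _ n n _ m]
    mult_carrier_mat [of _ n m _ m]
  have UUx: "conj_transpose U * (U * X) = X" if "X \<in> carrier_mat m k" for X k
    using that by (subst assoc_mult_mat [symmetric, of _ m m _ m _ k]) (auto simp: UU)
  have WWx: "W * (conj_transpose W * X) = X" if "X \<in> carrier_mat n k" for X k
    using that by (subst assoc_mult_mat [symmetric, of _ n n _ n _ k]) (auto simp: WW)
  have DDx: "diagonal m k f * (diagonal k l g * X) =
      diagonal m l (\<lambda>i. if i < k then f i * g i else 0) * X"
    if "X \<in> carrier_mat l l'" for X f g k l l'
    using that by (subst assoc_mult_mat [symmetric, of _ m k _ l _ l']) (auto simp: diagonal_mult)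
  have "\<exists>y. d i * d i * y = 1" if "i < r" for i
    using that appreciable_square_inverse mus by (auto simp: d_def r_def)
  then obtain y where y: "\<And>i. i < r \<Longrightarrow> d i * d i * y i = 1"
    by metis
  have conj_d: "conjugate (d i) = d i" for i
    by (simp add: d_def)
  have d_square: "d i * d i = 0" if "\<not> i < r" for i
    using nus that
    by (auto simp: d_def infinitesimal_def complex_of_dual_def dual.map_sel intro!: mult_infinitesimal)
  define P where "P = U * diagonal m m (\<lambda>i. if i < r then 1 else 0) * conj_transpose U"
  \<comment> \<open>\<open>Z\<close> inverts \<open>A * conj_transpose A\<close> on the range of
    \<open>P\<close>: its nonzero entries \<open>y i\<close> are the inverse squares of the
    appreciable singular values.\<close>
  define Z where "Z = U * diagonal m m (\<lambda>i. if i < r then y i else 0) * conj_transpose U"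
  have AA: "A * conj_transpose A =
      U * diagonal m m (\<lambda>i. if i < r then d i * d i else 0) * conj_transpose U"
  proof -
    have "conj_transpose A = conj_transpose W * (diagonal n m d * conj_transpose U)"
      unfolding AD by (simp add: conj_transpose_mult [of _ m n _ n] conj_transpose_mult [of _ m m _ n]
          conj_transpose_diagonal conj_d del: assoc_mult_mat)
    \<comment> \<open>Here the infinitesimal singular values drop out: their squares are zero, so
      the guard \<open>i < n\<close> coming from the product shrinks to
      \<open>i < r\<close>.\<close>
    moreover have "diagonal m m (\<lambda>i. if i < n then d i * d i else 0) =
        diagonal m m (\<lambda>i. if i < r then d i * d i else 0)"
      using len by (intro diagonal_cong) (auto simp: d_square)
    ultimately show ?thesis
      by (simp add: AD assoc WWx [of _ m] DDx [of _ _ m] del: assoc_mult_mat)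
  qed
  show thesis
  proof (rule that [of P Z])
    show "P \<in> carrier_mat m m" "Z \<in> carrier_mat m m"
      by (simp_all add: P_def Z_def)
    show "conj_transpose P = P"
      unfolding P_def
      by (auto simp: conj_transpose_mult [of _ m m _ m] conj_transpose_diagonal assoc
          simp del: assoc_mult_mat intro!: arg_cong2 [of _ _ _ _ "(*)"]
          diagonal_cong)
    have "P * A = U * (diagonal m n (\<lambda>i. if i < m then (if i < r then 1 else 0) * d i else 0) * W)"
      unfolding P_def AD
      by (simp add: assoc UUx [of _ n] DDx [of _ _ n] del: assoc_mult_mat)
    also have "diagonal m n (\<lambda>i. if i < m then (if i < r then 1 else 0) * d i else 0) = diagonal m n e"
      by (intro diagonal_cong) (simp add: e_def)
    finally show "P * A = E"
      by (simp add: ED assoc del: assoc_mult_mat)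
    have "P * (A * conj_transpose A) = U * (diagonal m m
        (\<lambda>i. if i < m then (if i < r then 1 else 0) * (if i < r then d i * d i else 0) else 0) *
        conj_transpose U)"
      unfolding P_def AA
      by (simp add: assoc UUx [of _ m] DDx [of _ _ m] del: assoc_mult_mat)
    also have "diagonal m m
        (\<lambda>i. if i < m then (if i < r then 1 else 0) * (if i < r then d i * d i else 0) else 0) =
        diagonal m m (\<lambda>i. if i < r then d i * d i else 0)"
      by (intro diagonal_cong) simp
    finally show "P * (A * conj_transpose A) = A * conj_transpose A"
      by (simp add: AA assoc del: assoc_mult_mat)
    have "A * conj_transpose A * Z = U * (diagonal m m
        (\<lambda>i. if i < m then (if i < r then d i * d i else 0) * (if i < r then y i else 0) else 0) *
        conj_transpose U)"
      unfolding Z_def AA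
      by (simp add: assoc UUx [of _ m] DDx [of _ _ m] del: assoc_mult_mat)
    also have "diagonal m m
        (\<lambda>i. if i < m then (if i < r then d i * d i else 0) * (if i < r then y i else 0) else 0) =
        diagonal m m (\<lambda>i. if i < r then 1 else 0)"
      by (intro diagonal_cong) (simp add: y)
    finally show "P = A * conj_transpose A * Z"
      by (simp add: P_def assoc del: assoc_mult_mat)
  qed
qed

text \<open>Each projector fixes \<open>?B\<close> from the left and is a right multiple of
  \<open>?B\<close>, so \<open>P * P' = P'\<close> and \<open>P' * P = P\<close>; taking adjoints
  identifies the two.\<close>

lemma essential_part_unique:
  assumes A: "A \<in> carrier_mat m n" and "is_essential_part A E" "is_essential_part A E'"
  shows "E = E'"
proof -
  let ?B = "A * conj_transpose A"
  obtain P Z where P: "P \<in> carrier_mat m m" "Z \<in> carrier_mat m m" "conj_transpose P = P" "P * A = E"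
    "P * ?B = ?B" "P = ?B * Z"
    using essential_part_projector [OF assms(1,2)] .
  obtain P' Z' where P': "P' \<in> carrier_mat m m" "Z' \<in> carrier_mat m m" "conj_transpose P' = P'"
    "P' * A = E'" "P' * ?B = ?B" "P' = ?B * Z'"
    using essential_part_projector [OF assms(1,3)] .
  have B: "?B \<in> carrier_mat m m"
    using A by simp
  have "P * P' = P'"
    using assoc_mult_mat [OF P(1) B P'(2)] P(5) P'(6) by simp
  moreover have "P' * P = P"
    using assoc_mult_mat [OF P'(1) B P(2)] P'(5) P(6) by simp
  ultimately have "P = P'"
    using conj_transpose_mult [OF P(1) P'(1)] P(3) P'(3) by simp
  then show ?thesis
    using P(4) P'(4) by simp
qed

section \<open>Moore-Penrose and group inverses of a square matrix\<close>

locale mp_inverse =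
  fixes n :: nat and E N :: "complex dual mat"
  assumes E [simp]: "E \<in> carrier_mat n n" and N [simp]: "N \<in> carrier_mat n n"
    and ENE: "E * N * E = E" and NEN: "N * E * N = N"
    and herm_EN: "conj_transpose (E * N) = E * N" and herm_NE: "conj_transpose (N * E) = N * E"
begin

definition P where "P = E * N"
definition Q where "Q = N * E"

lemmas assoc = assoc_mult_mat [of _ n n _ n _ n]
lemmas square_carrier [simp] = mult_carrier_mat [of _ n n _ n]

lemma PQ_carrier [simp]: "P \<in> carrier_mat n n" "Q \<in> carrier_mat n n"
  by (simp_all add: P_def Q_def)

text \<open>Words are normalised by nesting to the right; this lets a rule for a product of two
  factors act at the front of a longer word.\<close>

lemma extend:
  assumes "X * Y = Z" "X \<in> carrier_mat n n" "Y \<in> carrier_mat n n" "W \<in> carrier_mat n n"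
  shows "X * (Y * W) = Z * W"
  using assms by (simp flip: assoc)

lemma herm_P: "conj_transpose P = P" and herm_Q: "conj_transpose Q = Q"
  by (simp_all add: P_def Q_def herm_EN herm_NE)

lemma mp_mult: "E * N = P" "N * E = Q" "P * E = E" "E * Q = E" "N * P = N" "Q * N = N"
  "P * P = P" "Q * Q = Q"
proof -
  show base: "E * N = P" "N * E = Q" "P * E = E" "Q * N = N"
    by (simp_all only: P_def Q_def ENE NEN)
  show "E * Q = E" "N * P = N"
    using ENE NEN by (simp_all only: P_def Q_def assoc [OF E N E] assoc [OF N E N])
  then show "P * P = P" "Q * Q = Q"
    using assoc [of P E N] assoc [of Q N E] base by simp_all
qed

text \<open>Either equation nests the range of one projector in that of the other, and
  \<open>E * N\<close> and \<open>N * E\<close> have equal trace.\<close>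

lemma P_eq_Q_if_absorb:
  assumes "P * Q = Q \<or> P * Q = P"
  shows "P = Q"
proof -
  have tr: "mtrace P = mtrace Q"
    unfolding P_def Q_def by (rule mtrace_mult_commute [OF E N])
  from assms show ?thesis
  proof
    assume "P * Q = Q"
    then show ?thesis
      using tr by (intro nested_projectors_eq [of P n Q]) (simp_all add: herm_P herm_Q mp_mult)
  next
    assume "P * Q = P"
    then have "Q * P = P"
      using conj_transpose_mult [of P n n Q n] by (simp add: herm_P herm_Q)
    then show ?thesis
      using tr by (intro nested_projectors_eq [of Q n P, symmetric])
        (simp_all add: herm_P herm_Q mp_mult)
  qed
qed

text \<open>Multiplying by \<open>N\<close> from the left gives \<open>Q * P = Q\<close>, whose
  adjoint is \<open>P * Q = Q\<close>.\<close>

lemma P_eq_Q_if_EP: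
  assumes "E * P = E"
  shows "P = Q"
proof -
  have "Q * P = Q"
    using arg_cong [OF assms, of "\<lambda>X. N * X"] extend [OF mp_mult(2)] by (simp add: mp_mult)
  then have "P * Q = Q"
    using conj_transpose_mult [of Q n n P n] by (simp add: herm_P herm_Q)
  then show ?thesis
    by (rule P_eq_Q_if_absorb [OF disjI1])
qed

text \<open>Multiplying by \<open>N\<close> from the right gives \<open>Q * P = P\<close>, whose
  adjoint is \<open>P * Q = P\<close>.\<close>

lemma P_eq_Q_if_QE:
  assumes "Q * E = E"
  shows "P = Q"
proof -
  have "Q * P = P"
    using arg_cong [OF assms, of "\<lambda>X. X * N"] by (simp add: assoc mp_mult del: assoc_mult_mat)
  then have "P * Q = P"
    using conj_transpose_mult [of Q n n P n] by (simp add: herm_P herm_Q)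
  then show ?thesis
    by (rule P_eq_Q_if_absorb [OF disjI2])
qed

text \<open>\<open>P = Q\<close> says that \<open>E\<close> and \<open>N\<close> commute, which
  completes the group inverse equations.\<close>

lemma is_dggi_if_P_eq_Q: "P = Q \<Longrightarrow> is_dggi E N"
  unfolding is_dggi_def carrier_matD(1) [OF E] using ENE NEN
  by (simp add: P_def Q_def del: assoc_mult_mat)

end

section \<open>Projectors and cancellation in the presence of a group inverse\<close>

locale mp_group_inverse = mp_inverse +
  fixes G :: "complex dual mat"
  assumes dggi: "is_dggi E G"
begin

definition T where "T = E * G"

lemma G [simp]: "G \<in> carrier_mat n n"
  using dggi unfolding is_dggi_def carrier_matD(1) [OF E] by blast

lemma T_carrier [simp]: "T \<in> carrier_mat n n"
  by (simp add: T_def)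

lemma group_mult: "E * G = T" "G * E = T" "T * E = E" "E * T = E" "T * G = G" "G * T = G"
proof -
  have dg: "E * G * E = E" "G * E * G = G" "E * G = G * E"
    using dggi by (auto simp: is_dggi_def)
  show base: "E * G = T" "G * E = T" "T * E = E" "T * G = G"
    using dg(1,2) by (simp_all add: T_def flip: dg(3) del: assoc_mult_mat)
  show "E * T = E" "G * T = G"
    using dg(1,2) base assoc [of E G E] assoc [of G E G] by simp_all
qed

text \<open>\<open>P\<close> and \<open>T\<close> project onto the range of \<open>E\<close>, while \<open>Q\<close> and \<open>T\<close> have the kernel of \<open>E\<close>.\<close>

lemma projector_mult: "P * T = T" "T * P = P" "T * Q = T" "Q * T = Q" "P * G = G" "G * Q = G"
  "T * T = T"
proof -
  show PT: "P * T = T"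
    using assoc [of P E G] by (simp add: mp_mult group_mult)
  show "T * P = P"
    using assoc [of T E N] by (simp add: mp_mult group_mult)
  show TQ: "T * Q = T"
    using assoc [of G E Q] by (simp add: mp_mult group_mult)
  show "T * T = T"
    using assoc [of G E T] by (simp add: group_mult)
  show "Q * T = Q"
    using assoc [of N E T] by (simp add: mp_mult group_mult)
  show "P * G = G"
    using assoc [of P T G] PT by (simp add: group_mult)
  show "G * Q = G"
    using assoc [of G T Q] TQ by (simp add: group_mult)
qed

lemmas mults = mp_mult group_mult projector_mult
lemmas word_simps = mults mults [THEN extend] assoc

text \<open>Multiplying by \<open>E\<close> gives \<open>T * P = T\<close>, while
  \<open>T * P = P\<close> always; so \<open>P = T\<close>, and \<open>T * Q = T\<close> becomes an
  absorption.\<close>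

lemma P_eq_Q_if_GP:
  assumes "G * P = G"
  shows "P = Q"
proof -
  have "P = T"
    using arg_cong [OF assms, of "\<lambda>X. E * X"] by (simp add: word_simps del: assoc_mult_mat)
  then show ?thesis
    using projector_mult(3) by (intro P_eq_Q_if_absorb) simp
qed

text \<open>As \<open>Q * T = Q\<close> always, the assumption means \<open>Q = T\<close>, and
  \<open>P * T = T\<close> becomes an absorption.\<close>

lemma P_eq_Q_if_QT:
  assumes "Q * T = T"
  shows "P = Q"
  using assms projector_mult(1,4) by (intro P_eq_Q_if_absorb) simp

lemma P_eq_Q_if_QG:
  assumes "Q * G = G"
  shows "P = Q"
  using arg_cong [OF assms, of "\<lambda>X. X * E"]
  by (intro P_eq_Q_if_QT) (simp add: word_simps del: assoc_mult_mat)

text \<open>Two factors \<open>E\<close> cancel both factors \<open>G\<close>, since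
  \<open>G * G * E * E = T\<close>.\<close>

lemma P_eq_Q_if_QGG:
  assumes "Q * (G * G) = G * G"
  shows "P = Q"
  using arg_cong [OF assms, of "\<lambda>X. X * E * E"]
  by (intro P_eq_Q_if_QT) (simp add: word_simps del: assoc_mult_mat)

text \<open>Taking adjoints in \<open>T * P = P\<close> and \<open>T * Q = T\<close> shows that \<open>conj_transpose T\<close> inverts the
  compression of \<open>P\<close> to the range of \<open>Q\<close>; this makes \<open>N * N\<close> cancellable although \<open>P * Q\<close> is not
  a projector.\<close>

definition C where "C = E * conj_transpose T * E"

lemma C_carrier [simp]: "C \<in> carrier_mat n n"
  by (simp add: C_def)

text \<open>The inner \<open>E * N\<close> and \<open>N * E\<close> collapse to \<open>P\<close> and
  \<open>Q\<close>, which are absorbed next to \<open>conj_transpose T\<close>; what remains is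
  \<open>E * N\<close> and \<open>N * E\<close>.\<close>

lemma C_NN: "C * (N * N) = P" and NN_C: "N * (N * C) = Q"
proof -
  let ?S = "conj_transpose T"
  have S [simp]: "?S \<in> carrier_mat n n" by simp
  have S_mult: "?S * P = ?S" "P * ?S = P" "Q * ?S = ?S" "?S * Q = Q"
    using conj_transpose_mult [of P n n T n] conj_transpose_mult [of T n n P n]
      conj_transpose_mult [of T n n Q n] conj_transpose_mult [of Q n n T n]
    by (simp_all add: herm_P herm_Q projector_mult)
  have "?S * (P * N) = N"
  proof -
    have "?S * (P * N) = ?S * N"
      using S_mult(1) by (simp flip: assoc)
    also have "\<dots> = ?S * Q * N"
      by (simp add: assoc mp_mult del: assoc_mult_mat)
    also have "\<dots> = N"
      by (simp only: S_mult mp_mult)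
    finally show ?thesis .
  qed
  then show "C * (N * N) = P"
    by (simp add: C_def word_simps del: assoc_mult_mat)
  have "N * ?S * E = N * P * ?S * E"
    by (simp only: mp_mult)
  also have "\<dots> = N * (P * ?S) * E"
    by (simp add: assoc del: assoc_mult_mat)
  also have "\<dots> = Q"
    by (simp only: S_mult mp_mult)
  finally show "N * (N * C) = Q"
    using S_mult(3)
    by (simp add: C_def assoc extend [OF mp_mult(2)] extend [OF S_mult(3)] del: assoc_mult_mat)
qed

lemma C_NNx: "X \<in> carrier_mat n n \<Longrightarrow> C * (N * (N * X)) = P * X"
  using assoc [of C "N * N" X] C_NN by (simp add: assoc del: assoc_mult_mat)

text \<open>\<open>C\<close> on the left turns \<open>N * N\<close> into \<open>P\<close>, which
  \<open>G\<close> absorbs, leaving \<open>G * P = G\<close>.\<close>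

lemma P_eq_Q_if_NNG_P:
  assumes "N * N * G * P = N * N * G"
  shows "P = Q"
  using arg_cong [OF assms, of "\<lambda>X. C * X"]
  by (intro P_eq_Q_if_GP) (simp add: word_simps C_NNx del: assoc_mult_mat)

text \<open>\<open>C\<close> on the right turns \<open>N * N\<close> into \<open>Q\<close>, which
  \<open>G\<close> absorbs, leaving \<open>Q * G = G\<close>.\<close>

lemma P_eq_Q_if_Q_GNN:
  assumes "Q * (G * N * N) = G * N * N"
  shows "P = Q"
  using arg_cong [OF assms, of "\<lambda>X. X * C"]
  by (intro P_eq_Q_if_QG) (simp add: word_simps NN_C del: assoc_mult_mat)

lemma P_eq_Q_if_TN:
  assumes "T * N = G"
  shows "P = Q"
proof (rule P_eq_Q_if_GP)
  have "T * N * P = T * N"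
    by (simp add: word_simps del: assoc_mult_mat)
  then show "G * P = G"
    by (simp only: assms)
qed

text \<open>A word starting with \<open>N\<close> is fixed by \<open>Q\<close> on the left, one
  ending with \<open>N\<close> by \<open>P\<close> on the right. Each equation carries such an
  invariance over to its other side, and multiplying by \<open>E\<close> or \<open>C\<close> strips
  it down to one of the criteria above.\<close>

lemma group_conditions:
  shows "N * N = N * G \<Longrightarrow> P = Q"
    and "N * N = G * N \<Longrightarrow> P = Q"
    and "N * N = G * G \<Longrightarrow> P = Q"
    and "G * N = G * G \<Longrightarrow> P = Q"
    and "N * G = G * G \<Longrightarrow> P = Q"
    and "N * G = G * N \<Longrightarrow> P = Q"
    and "N * N * G = N * G * N \<Longrightarrow> P = Q"
    and "N * N * G = G * N * N \<Longrightarrow> P = Q"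
    and "N * G * N = G * N * N \<Longrightarrow> P = Q"
    and "N * G * G = G * N * G \<Longrightarrow> P = Q"
    and "N * G * G = G * G * N \<Longrightarrow> P = Q"
    and "G * G * N = G * N * G \<Longrightarrow> P = Q"
proof -
  note [simp del] = assoc_mult_mat
  show "P = Q" if h: "N * N = N * G"
  proof (rule P_eq_Q_if_GP)
    have "P * N = G"
      using arg_cong [OF h, of "\<lambda>X. E * X"] by (simp add: word_simps)
    then show "G * P = G"
      by (metis N PQ_carrier(1) assoc mp_mult(5))
  qed
  show "P = Q" if h: "N * N = G * N"
  proof (rule P_eq_Q_if_QG)
    have "N * Q = G"
      using arg_cong [OF h, of "\<lambda>X. X * E"] by (simp add: word_simps)
    then show "Q * G = G"
      by (metis N PQ_carrier(2) assoc mp_mult(6))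
  qed
  show "P = Q" if h: "N * N = G * G"
    by (rule P_eq_Q_if_QGG) (simp add: word_simps flip: h)
  show "P = Q" if h: "G * N = G * G"
    using arg_cong [OF h, of "\<lambda>X. E * X"]
    by (intro P_eq_Q_if_TN) (simp add: word_simps)
  show "P = Q" if h: "N * G = G * G"
    by (rule P_eq_Q_if_QGG) (simp add: word_simps flip: h)
  show "P = Q" if h: "N * G = G * N"
  proof (rule P_eq_Q_if_QG)
    have "Q * (G * N) = G * N"
      by (simp add: word_simps flip: h)
    from arg_cong [OF this, of "\<lambda>X. X * E"] show "Q * G = G"
      by (simp add: word_simps)
  qed
  show "P = Q" if h: "N * N * G = N * G * N"
    by (rule P_eq_Q_if_NNG_P, unfold h) (simp add: word_simps)
  show "P = Q" if h: "N * N * G = G * N * N"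
    by (rule P_eq_Q_if_NNG_P, unfold h) (simp add: word_simps)
  show "P = Q" if h: "N * G * N = G * N * N"
    by (rule P_eq_Q_if_Q_GNN, fold h) (simp add: word_simps)
  show "P = Q" if h: "N * G * G = G * N * G"
  proof (rule P_eq_Q_if_QG)
    have "Q * (G * N * G) = G * N * G"
      by (simp add: word_simps flip: h)
    \<comment> \<open>Here \<open>G * (E * P) * E = E\<close>, and the remaining
      \<open>G * N * E\<close> is \<open>G * Q = G\<close>.\<close>
    from arg_cong [OF this, of "\<lambda>X. X * (E * P) * E"] show "Q * G = G"
      by (simp add: word_simps)
  qed
  show "P = Q" if h: "N * G * G = G * G * N"
  proof (rule P_eq_Q_if_QGG)
    have "Q * (G * G * N) = G * G * N"
      by (simp add: word_simps flip: h)
    from arg_cong [OF this, of "\<lambda>X. X * E"] show "Q * (G * G) = G * G"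
      by (simp add: word_simps)
  qed
  show "P = Q" if h: "G * G * N = G * N * G"
  proof (rule P_eq_Q_if_GP)
    have "G * N * G * P = G * N * G"
      by (simp add: word_simps flip: h)
    \<comment> \<open>\<open>E * Q * E * G * N * G\<close> reduces to \<open>G\<close> through
      \<open>E * G = T\<close>, \<open>Q * T = Q\<close>, \<open>Q * N = N\<close>,
      \<open>E * N = P\<close> and \<open>P * G = G\<close>.\<close>
    from arg_cong [OF this, of "\<lambda>X. E * (Q * (E * X))"] show "G * P = G"
      by (simp add: word_simps)
  qed
qed

end

section \<open>Passing between \<open>A\<close> and its essential part, and the equivalences\<close>

context mp_inverse
begin

text \<open>If \<open>P = Q\<close>, then \<open>N\<close> itself is the group inverse; at
  \<open>G = N\<close> each of the conditions equates a word with itself.\<close>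

lemma P_eq_Q_iff_dggi:
  assumes "\<And>G. mp_group_inverse n E N G \<Longrightarrow> cond G \<Longrightarrow> P = Q" "cond N"
  shows "P = Q \<longleftrightarrow> (\<exists>G. is_dggi E G \<and> cond G)"
proof
  show "P = Q \<Longrightarrow> \<exists>G. is_dggi E G \<and> cond G"
    using assms(2) is_dggi_if_P_eq_Q by blast
  show "\<exists>G. is_dggi E G \<and> cond G \<Longrightarrow> P = Q"
    using assms(1) mp_group_inverse.intro [OF mp_inverse_axioms]
    by (auto simp: mp_group_inverse_axioms_def)
qed

end

text \<open>Uniqueness identifies \<open>E\<close> with \<open>A * N * A\<close>, and
  \<open>N * A * N = N\<close> then makes \<open>A\<close> and \<open>E\<close> interchangeable next
  to \<open>N\<close>.\<close>

lemma ndmpi_mult_essential_part: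
  assumes A: "A \<in> carrier_mat n n" and E: "is_essential_part A E" and N: "is_ndmpi A N"
  shows "E * N = A * N" "N * E = N * A" "A * N * A = E" "mp_inverse n E N"
proof -
  have Nc [simp]: "N \<in> carrier_mat n n"
    using A N by (simp add: is_ndmpi_def)
  note [simp] = A
  show ANA: "A * N * A = E"
    using N E essential_part_unique [OF A] by (auto simp: is_ndmpi_def)
  note square_carrier [simp] = mult_carrier_mat [of _ n n _ n]
  have Ec: "E \<in> carrier_mat n n"
    unfolding ANA [symmetric] by simp
  have NAN: "N * A * N = N"
    using N by (simp add: is_ndmpi_def)
  note assoc = assoc_mult_mat [of _ n n _ n _ n]
  show EN: "E * N = A * N"
    using NAN unfolding ANA [symmetric] by (simp add: assoc del: assoc_mult_mat)
  have "N * E = N * A * N * A"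
    unfolding ANA [symmetric] by (simp add: assoc del: assoc_mult_mat)
  then show NE: "N * E = N * A"
    by (simp only: NAN)
  show "mp_inverse n E N"
  proof
    have "A * N * E = A * (N * E)"
      using Ec by (simp add: assoc del: assoc_mult_mat)
    also have "\<dots> = E"
      using ANA unfolding NE by (simp add: assoc del: assoc_mult_mat)
    finally show "E * N * E = E"
      by (simp only: EN)
    show "N * E * N = N"
      by (simp only: NE NAN)
    show "conj_transpose (E * N) = E * N" "conj_transpose (N * E) = N * E"
      using N by (simp_all add: is_ndmpi_def EN NE)
  qed (use Ec in simp_all)
qed

text \<open>The Hermitian projectors \<open>E * X\<close> and \<open>E * Y\<close> absorb each other
  and so agree, as do \<open>X * E\<close> and \<open>Y * E\<close>; hence
  \<open>X = X * E * X = Y * E * X = Y * E * Y = Y\<close>.\<close>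

lemma mp_inverse_unique:
  assumes "mp_inverse n E X" "mp_inverse n E Y"
  shows "X = Y"
proof -
  interpret X: mp_inverse n E X by fact
  interpret Y: mp_inverse n E Y by fact
  note assoc = X.assoc
  have "Y.P * X.P = X.P"
    using assoc [of Y.P E X] by (simp add: Y.mp_mult X.mp_mult)
  moreover have "X.P * Y.P = Y.P"
    using assoc [of X.P E Y] by (simp add: Y.mp_mult X.mp_mult)
  ultimately have P: "X.P = Y.P"
    using conj_transpose_mult [of Y.P n n X.P n] by (simp add: X.herm_P Y.herm_P)
  have "X.Q * Y.Q = X.Q"
    using assoc [of X E Y.Q] by (simp add: Y.mp_mult X.mp_mult)
  moreover have "Y.Q * X.Q = Y.Q"
    using assoc [of Y E X.Q] by (simp add: Y.mp_mult X.mp_mult)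
  ultimately have Q: "X.Q = Y.Q"
    using conj_transpose_mult [of X.Q n n Y.Q n] by (simp add: X.herm_Q Y.herm_Q)
  have "X = X.Q * X"
    by (simp add: X.mp_mult)
  also have "\<dots> = Y * (E * X)"
    unfolding Q by (simp add: Y.Q_def assoc del: assoc_mult_mat)
  also have "\<dots> = Y"
    using P by (simp add: X.mp_mult Y.mp_mult)
  finally show ?thesis .
qed

theorem theorem3p8:
  fixes n :: nat and A E N :: "complex dual mat"
  assumes A: "A \<in> carrier_mat n n"
    and E: "is_essential_part A E"
    and N: "is_ndmpi A N"
  shows "(new_dual_EP A \<longleftrightarrow> (A * N * conj_transpose A = conj_transpose A * A * N)) \<and>
    (new_dual_EP A \<longleftrightarrow> (conj_transpose A * N * A = N * A * conj_transpose A)) \<and>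
    (new_dual_EP A \<longleftrightarrow> (\<exists>G. is_dggi E G \<and> N * N = N * G)) \<and>
    (new_dual_EP A \<longleftrightarrow> (\<exists>G. is_dggi E G \<and> N * N = G * N)) \<and>
    (new_dual_EP A \<longleftrightarrow> (\<exists>G. is_dggi E G \<and> N * N = G * G)) \<and>
    (new_dual_EP A \<longleftrightarrow> (\<exists>G. is_dggi E G \<and> G * N = G * G)) \<and>
    (new_dual_EP A \<longleftrightarrow> (\<exists>G. is_dggi E G \<and> N * G = G * G)) \<and>
    (new_dual_EP A \<longleftrightarrow> (\<exists>G. is_dggi E G \<and> N * G = G * N)) \<and>
    (new_dual_EP A \<longleftrightarrow> (\<exists>G. is_dggi E G \<and> N * N * G = N * G * N)) \<and>
    (new_dual_EP A \<longleftrightarrow> (\<exists>G. is_dggi E G \<and> N * N * G = G * N * N)) \<and>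
    (new_dual_EP A \<longleftrightarrow> (\<exists>G. is_dggi E G \<and> N * G * N = G * N * N)) \<and>
    (new_dual_EP A \<longleftrightarrow> (\<exists>G. is_dggi E G \<and> N * G * G = G * N * G)) \<and>
    (new_dual_EP A \<longleftrightarrow> (\<exists>G. is_dggi E G \<and> N * G * G = G * G * N)) \<and>
    (new_dual_EP A \<longleftrightarrow> (\<exists>G. is_dggi E G \<and> G * G * N = G * N * G))"
proof -
  note essential = ndmpi_mult_essential_part [OF A E N]
  interpret mp_inverse n E N
    by (rule essential)
  have AN: "A * N = P" and NA: "N * A = Q"
    by (simp_all add: P_def Q_def essential)
  have PA: "P * A = E" and AQ: "A * Q = E"
    using A essential(3) assoc [of A N A] by (simp_all add: AN NA)
  have EP: "new_dual_EP A \<longleftrightarrow> P = Q"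
  proof
    assume "new_dual_EP A"
    then obtain X where X: "is_ndmpi A X" "A * X = X * A"
      by (auto simp: new_dual_EP_def)
    \<comment> \<open>The inverse quantified in \<open>new_dual_EP\<close> must be the given
      \<open>N\<close>.\<close>
    have "X = N"
      using ndmpi_mult_essential_part(4) [OF assms(1,2) X(1)] essential(4)
      by (rule mp_inverse_unique)
    with X(2) show "P = Q"
      by (simp add: AN NA)
  qed (use assms(3) AN NA in \<open>auto simp: new_dual_EP_def\<close>)
  \<comment> \<open>Adjoints turn this condition into \<open>A * P = P * A\<close>, where
    \<open>P * A = E\<close>; then \<open>E * P = P * A * P = P * E = E\<close>.\<close>
  have ii: "P = Q \<longleftrightarrow> A * N * conj_transpose A = conj_transpose A * A * N"
  proof -
    have "A * N * conj_transpose A = conj_transpose (A * P)"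
      using conj_transpose_mult [of A n n P n] A by (simp add: AN herm_P)
    moreover have "conj_transpose A * A * N = conj_transpose (P * A)"
      using conj_transpose_mult [of P n n A n] assoc [of "conj_transpose A" A N] A
      by (simp add: AN herm_P)
    moreover have "conj_transpose (A * P) = conj_transpose (P * A) \<longleftrightarrow> A * P = E"
      by (metis PA conj_transpose_conj_transpose)
    moreover have "P = Q" if "A * P = E"
    proof (rule P_eq_Q_if_EP)
      have "E * P = P * (A * P)"
        using assoc [of P A P] A by (simp add: PA)
      then show "E * P = E"
        by (simp add: that mp_mult)
    qed
    moreover have "A * P = E" if "P = Q"
      by (simp only: that AQ)
    ultimately show ?thesis
      by metis
  qed
  \<comment> \<open>The mirror image: the condition becomes \<open>Q * A = A * Q\<close>, where
    \<open>A * Q = E\<close>.\<close>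
  have iii: "P = Q \<longleftrightarrow> conj_transpose A * N * A = N * A * conj_transpose A"
  proof -
    have "N * A * conj_transpose A = conj_transpose (A * Q)"
      using conj_transpose_mult [of A n n Q n] A by (simp add: NA herm_Q)
    moreover have "conj_transpose A * N * A = conj_transpose (Q * A)"
      using conj_transpose_mult [of Q n n A n] assoc [of "conj_transpose A" N A] A
      by (simp add: NA herm_Q)
    moreover have "conj_transpose (Q * A) = conj_transpose (A * Q) \<longleftrightarrow> Q * A = E"
      by (metis AQ conj_transpose_conj_transpose)
    moreover have "P = Q" if "Q * A = E"
    proof (rule P_eq_Q_if_QE)
      have "Q * E = Q * A * Q"
        using assoc [of Q A Q] A by (simp add: AQ)
      then show "Q * E = E"
        by (simp add: that mp_mult)
    qed
    moreover have "Q * A = E" if "P = Q"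
      using PA by (simp only: that)
    ultimately show ?thesis
      by metis
  qed
  show ?thesis
    unfolding EP
    by (intro conjI ii iii P_eq_Q_iff_dggi refl; erule (1) mp_group_inverse.group_conditions)
qed

end
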